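(* For integers $r\ge1$ and $n\ge0$ define the Schmidt polynomial $S_n^{(r)}(x)=\sum_{k=0}^{n}\binom{n}{k}^r\binom{n+k}{k}^rx^k$. Let $n$ be a positive integer, $r\ge2$ an integer and $x\in\mathbb{Z}$. Then $$\sum_{k=0}^{n-1}(2k+1)S_k^{(r)}(x)\equiv0\pmod n\qquad\text{and}\qquad\sum_{k=0}^{n-1}(-1)^k(2k+1)S_k^{(r)}(x)\equiv0\pmod n.$$ *)

theory Defs
  imports "HOL-Number_Theory.Number_Theory" "HOL-Computational_Algebra.Polynomial"
begin

text \<open>The definition is total in \<open>r\<close>; it is intended for \<open>r \<ge> 1\<close>.\<close>

definition schmidt_poly :: "nat \<Rightarrow> nat \<Rightarrow> int poly" where
  "schmidt_poly r n =
     (\<Sum>k=0..n. monom (int (n choose k) ^ r * int ((n + k) choose k) ^ r) k)"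

end

theory Submission
  imports Defs
begin

text \<open>
  Put \<open>a\<^sub>j(k) = C(k,j) C(k+j,j)\<close>.  The product \<open>a\<^sub>i a\<^sub>j\<close> is an integer linear
  combination of the \<open>a\<^sub>s\<close> (a form of the Pfaff-Saalschuetz identity), so by induction on \<open>r\<close> the
  claim for \<open>a\<^sub>j\<^sup>r\<close> reduces to the claim for a single \<open>a\<^sub>j\<close>.  There both sums telescope to a closed
  form with a visible factor \<open>n\<close>.
\<close>

definition schmidt_coeff :: "nat \<Rightarrow> nat \<Rightarrow> int" where
  "schmidt_coeff k j = int (k choose j) * int ((k + j) choose j)"

lemma poly_schmidt_poly:
  "poly (schmidt_poly r k) x = (\<Sum>j\<le>k. schmidt_coeff k j ^ r * x ^ j)"
  by (simp add: schmidt_poly_def schmidt_coeff_def poly_sum poly_monom power_mult_distrib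
      atLeast0AtMost)

text \<open>With subtraction in the integers the absorption identity needs no bound on
  \<open>j\<close>: for \<open>j > k\<close> both binomials vanish. Later algebra can then avoid
  case distinctions.\<close>

lemma of_nat_Suc_times_binomial_Suc:
  "(int j + 1) * int (k choose Suc j) = (int k - int j) * int (k choose j)"
proof (cases "j \<le> k")
  case True
  have "Suc j * (k choose Suc j) = (k - j) * (k choose j)"
    by (metis binomial_absorption binomial_absorb_comp mult.commute)
  then have "int (Suc j * (k choose Suc j)) = int ((k - j) * (k choose j))" by simp
  then show ?thesis using True by (simp add: of_nat_diff algebra_simps)
qed (simp add: binomial_eq_0)

lemma of_nat_diff_times_binomial_Suc:
  "(int k + 1 - int j) * int (Suc k choose j) = (int k + 1) * int (k choose j)"
proof (cases j)
  case (Suc m)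
  show ?thesis
    using of_nat_Suc_times_binomial_Suc[of m k] unfolding Suc by (simp add: algebra_simps)
qed simp

lemma of_nat_Suc_times_binomial:
  "(int j + 1) * int (Suc k choose Suc j) = (int k + 1) * int (k choose j)"
  using arg_cong[OF Suc_times_binomial[of j k], of int] by (simp add: algebra_simps)

lemma of_nat_Suc_times_binomial_add:
  "(int k + 1) * int (Suc (k + j) choose j) = (int k + int j + 1) * int ((k + j) choose j)"
  using of_nat_diff_times_binomial_Suc[of "k + j" j] by (simp add: algebra_simps)

text \<open>Since \<open>(k - m)(k + m + 1) = k(k+1) - m(m+1)\<close>, iterating this shows that
  \<open>schmidt_coeff k m\<close> is a polynomial of degree \<open>m\<close> in
  \<open>k(k+1)\<close>, which is what makes products expandable.\<close>

lemma schmidt_coeff_Suc: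
  "(int m + 1)\<^sup>2 * schmidt_coeff k (Suc m)
     = (int k - int m) * (int k + int m + 1) * schmidt_coeff k m"
proof -
  have "(int m + 1)\<^sup>2 * schmidt_coeff k (Suc m)
     = ((int m + 1) * int (k choose Suc m)) * ((int m + 1) * int (Suc (k + m) choose Suc m))"
    by (simp only: schmidt_coeff_def power2_eq_square mult_ac add_Suc_right)
  also have "\<dots> = ((int k - int m) * int (k choose m)) * ((int k + int m + 1) * int ((k + m) choose m))"
    unfolding of_nat_Suc_times_binomial unfolding of_nat_Suc_times_binomial_Suc by simp
  finally show ?thesis by (simp add: schmidt_coeff_def mult_ac)
qed

text \<open>The coefficient of \<open>schmidt_coeff k (i + l)\<close> in the product of those with
  indices \<open>i\<close> and \<open>j\<close>. Written with binomials only, it is visibly an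
  integer independent of \<open>k\<close>.\<close>

definition linearization_coeff :: "nat \<Rightarrow> nat \<Rightarrow> nat \<Rightarrow> int" where
  "linearization_coeff i j l = int ((i + j) choose i) * int (j choose l) * int ((i + l) choose j)"

lemma linearization_coeff_eq_0: "j < l \<Longrightarrow> linearization_coeff i j l = 0"
  by (simp add: linearization_coeff_def)

lemma binomial_add_Suc_left:
  "(int j + 1) * int ((i + Suc j) choose i) = (int i + int j + 1) * int ((i + j) choose i)"
  using of_nat_Suc_times_binomial_add[of j i] by (simp add: add.commute)

lemma linearization_coeff_Suc_0:
  "(int j + 1)\<^sup>2 * linearization_coeff i (Suc j) 0
     = (int i - int j) * (int i + int j + 1) * linearization_coeff i j 0"
proof -
  have "(int j + 1)\<^sup>2 * linearization_coeff i (Suc j) 0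
     = ((int j + 1) * int ((i + Suc j) choose i)) * ((int j + 1) * int (i choose Suc j))"
    by (simp add: linearization_coeff_def power2_eq_square)
  then show ?thesis
    unfolding of_nat_Suc_times_binomial_Suc binomial_add_Suc_left
    by (simp add: linearization_coeff_def)
qed

text \<open>Comparison of the coefficients of index \<open>i + l + 1\<close> when the expansion for
  \<open>j\<close> is multiplied by \<open>k(k+1) - j(j+1)\<close>: index \<open>i + l\<close>
  contributes by raising, index \<open>i + l + 1\<close> by its diagonal part. For
  \<open>l = 0\<close> in the previous lemma only the diagonal part exists.\<close>

lemma linearization_coeff_Suc_Suc:
  "(int j + 1)\<^sup>2 * linearization_coeff i (Suc j) (Suc l)
     = (int (i + l) + 1)\<^sup>2 * linearization_coeff i j l
       + (int (i + Suc l) - int j) * (int (i + Suc l) + int j + 1) * linearization_coeff i j (Suc l)"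
proof -
  define s where "s = i + l"
  define B where "B = int ((i + j) choose i)"
  \<comment> \<open>\<open>D\<close> is the common multiple through which
    \<open>Suc s choose Suc j\<close>, \<open>s choose j\<close> and \<open>Suc s choose j\<close>,
    the last factors of the three coefficients, are compared.\<close>
  define D where "D = (int s + 1 - int j) * int (Suc s choose j)"
  define p where "p = int (j choose l)"
  define q where "q = int (j choose Suc l)"
  have pq: "(int l + 1) * q = (int j - int l) * p"
    unfolding p_def q_def by (rule of_nat_Suc_times_binomial_Suc)
  have D1: "(int j + 1) * int (Suc s choose Suc j) = D"
    unfolding D_def using of_nat_Suc_times_binomial_Suc[of j "Suc s"] by simp
  have D2: "(int s + 1) * int (s choose j) = D"
    unfolding D_def using of_nat_diff_times_binomial_Suc[of s j] by simp
  have "(int j + 1)\<^sup>2 * linearization_coeff i (Suc j) (Suc l)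
     = ((int j + 1) * int ((i + Suc j) choose i)) * (q + p)
         * ((int j + 1) * int (Suc s choose Suc j))"
    unfolding linearization_coeff_def s_def p_def q_def
    by (simp only: power2_eq_square mult_ac add_Suc_right binomial_Suc_Suc of_nat_add add_ac)
  also have "\<dots> = (int i + int j + 1) * B * (q + p) * D"
    unfolding D1 binomial_add_Suc_left B_def ..
  also have "\<dots> = B * D * ((int s + 1) * p + (int s + int j + 2) * q)"
  proof -
    \<comment> \<open>The two sides differ by \<open>(j - l) p - (l + 1) q\<close>, which is zero by
      \<open>pq\<close>.\<close>
    have "(int i + int j + 1) * (q + p) = (int s + 1) * p + (int s + int j + 2) * q"
      using pq by (simp add: s_def algebra_simps)
    then show ?thesis by (metis mult.assoc mult.commute)
  qed
  also have "\<dots> = (int s + 1) * B * p * ((int s + 1) * int (s choose j))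
       + (int s + int j + 2) * B * q * D"
    unfolding D2 by (simp add: algebra_simps)
  also have "\<dots> = (int (i + l) + 1)\<^sup>2 * linearization_coeff i j l
       + (int (i + Suc l) - int j) * (int (i + Suc l) + int j + 1) * linearization_coeff i j (Suc l)"
    unfolding linearization_coeff_def s_def[symmetric] B_def p_def q_def D_def add_Suc_right
    by (simp add: power2_eq_square algebra_simps)
  finally show ?thesis .
qed

text \<open>
  Both sides are polynomials in \<open>X = k(k+1)\<close>; passing from \<open>j\<close> to \<open>j + 1\<close> multiplies by
  \<open>X - j(j+1)\<close>, which is split as \<open>(X - s(s+1)) + (s(s+1) - j(j+1))\<close> on the term with index \<open>s\<close>.
\<close>

lemma schmidt_coeff_mult:
  "schmidt_coeff k i * schmidt_coeff k j
     = (\<Sum>l\<le>j. linearization_coeff i j l * schmidt_coeff k (i + l))"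
proof (induction j)
  case 0
  show ?case by (simp add: linearization_coeff_def schmidt_coeff_def)
next
  case (Suc j)
  let ?a = "\<lambda>l. schmidt_coeff k (i + l)"
  let ?d = "linearization_coeff i j"
  let ?u = "\<lambda>l. (int (i + l) - int j) * (int (i + l) + int j + 1)"
  let ?v = "\<lambda>l. (int (i + l) + 1)\<^sup>2"
  have step: "(int k - int j) * (int k + int j + 1) * ?a l = ?v l * ?a (Suc l) + ?u l * ?a l" for l
    using schmidt_coeff_Suc[of "i + l" k] by (simp add: algebra_simps)
  \<comment> \<open>The factor \<open>(j + 1)\<^sup>2\<close> avoids division and is cancelled at
    the end.\<close>
  have "(int j + 1)\<^sup>2 * (schmidt_coeff k i * schmidt_coeff k (Suc j))
      = (int k - int j) * (int k + int j + 1) * (schmidt_coeff k i * schmidt_coeff k j)"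
    using schmidt_coeff_Suc[of j k] by (metis mult.left_commute)
  also have "\<dots> = (\<Sum>l\<le>j. ?d l * ((int k - int j) * (int k + int j + 1) * ?a l))"
    unfolding Suc.IH sum_distrib_left by (simp add: mult_ac)
  also have "\<dots> = (\<Sum>l\<le>j. ?v l * ?d l * ?a (Suc l)) + (\<Sum>l\<le>j. ?u l * ?d l * ?a l)"
    unfolding step by (simp add: sum.distrib[symmetric] distrib_left mult_ac)
  \<comment> \<open>The added term is zero; after the index shift both sums run over
    \<open>?a (Suc l)\<close>.\<close>
  also have "(\<Sum>l\<le>j. ?u l * ?d l * ?a l) = (\<Sum>l\<le>Suc j. ?u l * ?d l * ?a l)"
    by (simp add: linearization_coeff_eq_0)
  also have "\<dots> = ?u 0 * ?d 0 * ?a 0 + (\<Sum>l\<le>j. ?u (Suc l) * ?d (Suc l) * ?a (Suc l))"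
    by (rule sum.atMost_Suc_shift)
  also have "(\<Sum>l\<le>j. ?v l * ?d l * ?a (Suc l))
        + (?u 0 * ?d 0 * ?a 0 + (\<Sum>l\<le>j. ?u (Suc l) * ?d (Suc l) * ?a (Suc l)))
      = ?u 0 * ?d 0 * ?a 0 + (\<Sum>l\<le>j. (?v l * ?d l + ?u (Suc l) * ?d (Suc l)) * ?a (Suc l))"
    by (simp only: sum.distrib distrib_right add_ac)
  also have "\<dots> = (int j + 1)\<^sup>2 * linearization_coeff i (Suc j) 0 * ?a 0
      + (\<Sum>l\<le>j. (int j + 1)\<^sup>2 * linearization_coeff i (Suc j) (Suc l) * ?a (Suc l))"
    unfolding linearization_coeff_Suc_Suc linearization_coeff_Suc_0 by simp
  also have "\<dots> = (int j + 1)\<^sup>2 * (\<Sum>l\<le>Suc j. linearization_coeff i (Suc j) l * ?a l)"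
    unfolding sum.atMost_Suc_shift by (simp add: distrib_left sum_distrib_left mult.assoc)
  finally show ?case
    by simp
qed

text \<open>The extra factor of index \<open>i\<close> strengthens the induction: linearization
  absorbs one factor of the power into it, moving \<open>i\<close> to \<open>i + l\<close>, so
  \<open>i\<close> must be arbitrary.\<close>

lemma dvd_sum_schmidt_coeff_power:
  fixes m :: int and w :: "nat \<Rightarrow> int"
  assumes "\<And>i. m dvd (\<Sum>k<n. w k * schmidt_coeff k i)"
  shows "m dvd (\<Sum>k<n. w k * (schmidt_coeff k i * schmidt_coeff k j ^ r))"
proof (induction r arbitrary: i)
  case 0
  show ?case using assms by simp
next
  case (Suc r)
  have "(\<Sum>k<n. w k * (schmidt_coeff k i * schmidt_coeff k j ^ Suc r))
      = (\<Sum>k<n. w k * ((schmidt_coeff k i * schmidt_coeff k j) * schmidt_coeff k j ^ r))"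
    by (simp add: mult_ac)
  also have "\<dots> = (\<Sum>k<n. \<Sum>l\<le>j. linearization_coeff i j l
                    * (w k * (schmidt_coeff k (i + l) * schmidt_coeff k j ^ r)))"
    unfolding schmidt_coeff_mult by (simp add: sum_distrib_left sum_distrib_right mult_ac)
  also have "\<dots> = (\<Sum>l\<le>j. linearization_coeff i j l
                    * (\<Sum>k<n. w k * (schmidt_coeff k (i + l) * schmidt_coeff k j ^ r)))"
    by (subst sum.swap) (simp add: sum_distrib_left)
  also have "m dvd \<dots>"
    by (intro dvd_sum dvd_mult Suc.IH)
  finally show ?case .
qed

lemma dvd_sum_poly_schmidt_poly:
  fixes m :: int and w :: "nat \<Rightarrow> int"
  assumes "\<And>i. m dvd (\<Sum>k<n. w k * schmidt_coeff k i)" and "r > 0"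
  shows "m dvd (\<Sum>k<n. w k * poly (schmidt_poly r k) x)"
proof -
  \<comment> \<open>A range independent of \<open>k\<close> lets the sums be swapped. The new terms
    vanish because \<open>r > 0\<close> excludes \<open>0 ^ 0\<close>.\<close>
  have "poly (schmidt_poly r k) x = (\<Sum>j<n. schmidt_coeff k j ^ r * x ^ j)" if "k < n" for k
    unfolding poly_schmidt_poly using that \<open>r > 0\<close>
    by (intro sum.mono_neutral_left) (auto simp: schmidt_coeff_def)
  then have "(\<Sum>k<n. w k * poly (schmidt_poly r k) x)
      = (\<Sum>k<n. \<Sum>j<n. x ^ j * (w k * (schmidt_coeff k 0 * schmidt_coeff k j ^ r)))"
    by (simp add: sum_distrib_left schmidt_coeff_def mult_ac)
  also have "\<dots> = (\<Sum>j<n. x ^ j * (\<Sum>k<n. w k * (schmidt_coeff k 0 * schmidt_coeff k j ^ r)))"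
    by (subst sum.swap) (simp add: sum_distrib_left)
  also have "m dvd \<dots>"
    by (intro dvd_sum dvd_mult dvd_sum_schmidt_coeff_power assms(1))
  finally show ?thesis .
qed

lemma sum_schmidt_coeff:
  "(\<Sum>k<n. (2 * int k + 1) * schmidt_coeff k j)
     = int n * int (n choose Suc j) * int ((n + j) choose j)"
proof (induction n)
  case (Suc n)
  let ?b = "int ((n + j) choose j)" and ?b' = "int (Suc (n + j) choose j)"
  let ?c = "int (n choose j)"
  \<comment> \<open>Scaling by \<open>j + 1\<close> turns each binomial over \<open>Suc j\<close>
    into a multiple of \<open>n choose j\<close>.\<close>
  have "(int j + 1) * (\<Sum>k<Suc n. (2 * int k + 1) * schmidt_coeff k j)
      = int n * ((int j + 1) * int (n choose Suc j)) * ?b + (int j + 1) * (2 * int n + 1) * ?c * ?b"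
    using Suc.IH by (simp add: schmidt_coeff_def algebra_simps)
  also have "\<dots> = (int n + 1) * ?c * ((int n + int j + 1) * ?b)"
    unfolding of_nat_Suc_times_binomial_Suc by (simp add: algebra_simps)
  also have "\<dots> = (int n + 1) * ((int n + 1) * ?c) * ?b'"
    unfolding of_nat_Suc_times_binomial_add[symmetric] by (simp only: mult_ac)
  also have "\<dots> = (int j + 1) * (int (Suc n) * int (Suc n choose Suc j) * int ((Suc n + j) choose j))"
    unfolding of_nat_Suc_times_binomial[symmetric] by (simp add: mult_ac add_ac)
  finally show ?case by simp
qed simp

text \<open>Telescopes because \<open>2n + 1 = (n - j) + (n + j + 1)\<close> and
  \<open>(n + j + 1)\<close> times the coefficient at \<open>n\<close> equals
  \<open>(n + 1 - j)\<close> times the one at \<open>n + 1\<close>.\<close>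

lemma alternating_sum_schmidt_coeff:
  "(\<Sum>k<n. (-1) ^ k * (2 * int k + 1) * schmidt_coeff k j)
     = - ((-1) ^ n * (int n - int j) * schmidt_coeff n j)"
proof (induction n)
  case 0
  show ?case by (cases j) (simp_all add: schmidt_coeff_def)
next
  case (Suc n)
  have "(int (Suc n) - int j) * schmidt_coeff (Suc n) j
      = (int n + 1 - int j) * int (Suc n choose j) * int (Suc (n + j) choose j)"
    by (simp add: schmidt_coeff_def algebra_simps)
  also have "\<dots> = int (n choose j) * ((int n + 1) * int (Suc (n + j) choose j))"
    unfolding of_nat_diff_times_binomial_Suc by (simp only: mult_ac)
  also have "\<dots> = (int n + int j + 1) * schmidt_coeff n j"
    unfolding of_nat_Suc_times_binomial_add by (simp add: schmidt_coeff_def mult_ac)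
  finally have "(-1) ^ n * ((int (Suc n) - int j) * schmidt_coeff (Suc n) j)
      = (-1) ^ n * ((int n + int j + 1) * schmidt_coeff n j)"
    by simp
  then show ?case using Suc.IH by (simp add: algebra_simps)
qed

text \<open>For \<open>n > 0\<close> the factor \<open>n\<close> comes from
  \<open>(n - j) C(n,j) = n C(n-1,j)\<close>.\<close>

lemma dvd_diff_times_schmidt_coeff: "int n dvd (int n - int j) * schmidt_coeff n j"
proof (cases n)
  case 0
  then show ?thesis by (cases j) (simp_all add: schmidt_coeff_def)
next
  case (Suc m)
  have "(int n - int j) * int (n choose j) = int n * int (m choose j)"
    using of_nat_diff_times_binomial_Suc[of m j] by (simp add: Suc algebra_simps)
  then show ?thesis
    by (metis dvd_triv_left mult.assoc schmidt_coeff_def)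
qed

theorem theorem4p1:
  fixes n r :: nat and x :: int
  assumes "n > 0" and "r \<ge> 2"
  shows "[(\<Sum>k=0..n - 1. (2 * int k + 1) * poly (schmidt_poly r k) x) = 0] (mod int n) \<and>
         [(\<Sum>k=0..n - 1. (-1) ^ k * (2 * int k + 1) * poly (schmidt_poly r k) x) = 0] (mod int n)"
proof -
  have range: "{0..n - 1} = {..<n}" using assms(1) by auto
  have "int n dvd (\<Sum>k<n. (2 * int k + 1) * poly (schmidt_poly r k) x)"
    using assms(2) by (intro dvd_sum_poly_schmidt_poly) (auto simp: sum_schmidt_coeff mult.assoc)
  moreover have "int n dvd (\<Sum>k<n. (-1) ^ k * (2 * int k + 1) * poly (schmidt_poly r k) x)"
  proof (rule dvd_sum_poly_schmidt_poly)
    show "int n dvd (\<Sum>k<n. (-1) ^ k * (2 * int k + 1) * schmidt_coeff k i)" for i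
      unfolding alternating_sum_schmidt_coeff
      by (simp add: mult.assoc dvd_mult dvd_diff_times_schmidt_coeff)
  qed (use assms(2) in simp)
  ultimately show ?thesis unfolding range cong_0_iff by blast
qed

end
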